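(* Let $N,M\in\mathbb{N}$, $y\in\mathbb{C}^N$, $\mu>0$, let $A\in\mathbb{C}^{N\times M}$ have full row rank and let $D\in\mathbb{C}^{M\times M}$. Consider the complex-valued generalized LASSO problem $$\min_{x\in\mathbb{C}^M}\ \|y-Ax\|_2^2+\mu\|Dx\|_1 ,$$ rewritten equivalently as $$\min_{x,z\in\mathbb{C}^M}\ \|y-Ax\|_2^2+\mu\|z\|_1\quad\text{subject to}\quad z=Dx,$$ with Lagrangian $$\mathcal{L}(x,z,u)=\|y-Ax\|_2^2+\mu\|z\|_1+\mathrm{Re}\left[u^H(Dx-z)\right],\qquad u\in\mathbb{C}^M .$$ Let $A^+$ be the Moore--Penrose pseudoinverse of $A$, put $\tilde D=\tfrac12 DA^+$ and $\tilde y=AA^+y$, and let $U$ be a matrix whose columns form an orthonormal basis of the null space $\{\xi\in\mathbb{C}^M: A\xi=0\}$. Then the Lagrangian dual problem, i.e. the problem of maximizing $\inf_{x,z\in\mathbb{C}^M}\mathcal{L}(x,z,u)$ over $u\in\mathbb{C}^M$, is $$\max_{u\in\mathbb{C}^M}\ y^Hy-\|\tilde y-\tilde D^Hu\|_2^2\quad\text{subject to}\quad \|u\|_\infty\le\mu,\qquad (DU)^Hu=0 .$$ That is, for every $u\in\mathbb{C}^M$, $$\inf_{x,z\in\mathbb{C}^M}\mathcal{L}(x,z,u)=\begin{cases} y^Hy-\|\tilde y-\tilde D^Hu\|_2^2, & \text{if } \|u\|_\infty\le\mu \text{ and } (DU)^Hu=0,\\ -\infty, &\text{otherwise.}\end{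cases}$$
   Context: $X^H$ denotes the Hermitian (conjugate) transpose. For $v\in\mathbb{C}^M$, $\|v\|_1=\sum_m|v_m|$ and $\|v\|_\infty=\max_m|v_m|$, where $|\cdot|$ is the complex modulus. If the null space of $A$ is trivial, the constraint $(DU)^Hu=0$ is vacuous. *)

theory Defs
  imports
    "HOL-Library.Extended_Real"
    "Jordan_Normal_Form.Matrix_Kernel"
    "Jordan_Normal_Form.DL_Rank"
    "Jordan_Normal_Form.Schur_Decomposition"
begin

text \<open>Throughout, \<open>mat_adjoint X\<close> is $X^H$, and since \<open>v \<bullet>c w\<close> conjugates its right
  argument, $u^H w$ is written \<open>w \<bullet>c u\<close>.\<close>

definition norm1_vec :: "complex vec \<Rightarrow> real" where
  "norm1_vec v = (\<Sum>m<dim_vec v. cmod (v $ m))"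

definition norm2_vec :: "complex vec \<Rightarrow> real" where
  "norm2_vec v = sqrt (\<Sum>m<dim_vec v. (cmod (v $ m))\<^sup>2)"

text \<open>Inserting \<open>0\<close> only matters for the empty vector, whose norm is thereby \<open>0\<close>.\<close>

definition norm_inf_vec :: "complex vec \<Rightarrow> real" where
  "norm_inf_vec v = Max (insert 0 ((\<lambda>m. cmod (v $ m)) ` {..<dim_vec v}))"

definition moore_penrose :: "complex mat \<Rightarrow> complex mat \<Rightarrow> bool" where
  "moore_penrose A X \<longleftrightarrow>
     X \<in> carrier_mat (dim_col A) (dim_row A) \<and>
     A * X * A = A \<and> X * A * X = X \<and>
     mat_adjoint (A * X) = A * X \<and> mat_adjoint (X * A) = X * A"

definition pinv :: "complex mat \<Rightarrow> complex mat" where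
  "pinv A = (THE X. moore_penrose A X)"

text \<open>The number of columns of \<open>U\<close> may be \<open>0\<close>, namely when the null space is trivial.\<close>

definition orthonormal_kernel_basis :: "complex mat \<Rightarrow> complex mat \<Rightarrow> bool" where
  "orthonormal_kernel_basis A U \<longleftrightarrow>
     dim_row U = dim_col A \<and>
     kernel.basis (dim_col A) A (set (cols U)) \<and>
     (\<forall>i<dim_col U. \<forall>j<dim_col U. col U i \<bullet>c col U j = (if i = j then 1 else 0))"

definition lasso_objective ::
  "complex vec \<Rightarrow> complex mat \<Rightarrow> complex mat \<Rightarrow> real \<Rightarrow> complex vec \<Rightarrow> real" where
  "lasso_objective y A D \<mu> x = (norm2_vec (y - A *\<^sub>v x))\<^sup>2 + \<mu> * norm1_vec (D *\<^sub>v x)"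

definition split_objective ::
  "complex vec \<Rightarrow> complex mat \<Rightarrow> real \<Rightarrow> complex vec \<Rightarrow> complex vec \<Rightarrow> real" where
  "split_objective y A \<mu> x z = (norm2_vec (y - A *\<^sub>v x))\<^sup>2 + \<mu> * norm1_vec z"

definition split_feasible :: "complex mat \<Rightarrow> (complex vec \<times> complex vec) set" where
  "split_feasible D =
     {(x, z). x \<in> carrier_vec (dim_col D) \<and> z \<in> carrier_vec (dim_row D) \<and> z = D *\<^sub>v x}"

definition lagrangian ::
  "complex vec \<Rightarrow> complex mat \<Rightarrow> complex mat \<Rightarrow> real \<Rightarrow>
   complex vec \<Rightarrow> complex vec \<Rightarrow> complex vec \<Rightarrow> real" where
  "lagrangian y A D \<mu> x z u =
     (norm2_vec (y - A *\<^sub>v x))\<^sup>2 + \<mu> * norm1_vec z + Re ((D *\<^sub>v x - z) \<bullet>c u)"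

definition dual_function ::
  "complex vec \<Rightarrow> complex mat \<Rightarrow> complex mat \<Rightarrow> real \<Rightarrow> complex vec \<Rightarrow> ereal" where
  "dual_function y A D \<mu> u =
     (INF (x, z) \<in> carrier_vec (dim_col D) \<times> carrier_vec (dim_row D).
        ereal (lagrangian y A D \<mu> x z u))"

definition D_tilde :: "complex mat \<Rightarrow> complex mat \<Rightarrow> complex mat" where
  "D_tilde A D = (1 / 2) \<cdot>\<^sub>m (D * pinv A)"

definition y_tilde :: "complex mat \<Rightarrow> complex vec \<Rightarrow> complex vec" where
  "y_tilde A y = (A * pinv A) *\<^sub>v y"

definition dual_objective ::
  "complex vec \<Rightarrow> complex mat \<Rightarrow> complex mat \<Rightarrow> complex vec \<Rightarrow> real" where
  "dual_objective y A D u =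
     Re (y \<bullet>c y) - (norm2_vec (y_tilde A y - mat_adjoint (D_tilde A D) *\<^sub>v u))\<^sup>2"

definition dual_feasible :: "complex mat \<Rightarrow> complex mat \<Rightarrow> real \<Rightarrow> complex vec set" where
  "dual_feasible D U \<mu> =
     {u \<in> carrier_vec (dim_row D).
        norm_inf_vec u \<le> \<mu> \<and> mat_adjoint (D * U) *\<^sub>v u = 0\<^sub>v (dim_col U)}"

end

theory Submission
  imports Defs
begin

text \<open>
  The Lagrangian separates into a part depending only on $x$ and a part depending only on $z$:
  \[ \mathcal{L}(x,z,u) = \bigl(\|y-Ax\|_2^2 + \mathrm{Re}[u^H D x]\bigr)
       + \bigl(\mu\|z\|_1 - \mathrm{Re}[u^H z]\bigr). \]

  The $z$-part is positively homogeneous, so its infimum is $0$ or $-\infty$. It is nonnegative when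
  every entry of $u$ has modulus at most $\mu$ (\<open>Re_cprod_le\<close>), and if $|u_m|>\mu$ it decreases
  linearly along the ray spanned by $u_m e_m$ (\<open>dual_function_norm_inf_gt\<close>).

  The $x$-part is unbounded below as soon as the linear form $x \mapsto u^H D x$ is nonzero at some
  $\xi$ with $A\xi=0$: the quadratic term is constant along $\xi$
  (\<open>dual_function_not_orthogonal\<close>). That the form vanishes on the null space is exactly
  $(DU)^H u=0$, because the null space is the range of $U$ (\<open>adjoint_constraint_iff\<close>).
  In this case the form sees $x$ only through $b=Ax$: since $x-A^+Ax$ lies in the null space,
  $u^H D x = 2\,p^H b$ with $p=\tilde D^H u$ (\<open>cprod_D_tilde\<close>), and completing the square gives
  \[ \|y-b\|_2^2 + 2\,\mathrm{Re}[p^H b] = y^H y - \|y-p\|_2^2 + \|y-b-p\|_2^2 . \]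
  Full row rank makes $A A^+$ the identity (\<open>pinv_full_row_rank\<close>). Hence $\tilde y = y$, and
  $x=A^+(y-p)$ annihilates the last square, so that the infimum is attained there with $z=0$
  (\<open>dual_function_feasible\<close>).

  The statements about the optimization problems follow formally: points where the dual function
  is $-\infty$ affect neither a supremum nor a maximizer, the latter because $u=0$ is always feasible.
\<close>

section \<open>Adjoints and inner products\<close>

lemma cprod_sum:
  fixes v w :: "complex vec"
  assumes "v \<in> carrier_vec n" "w \<in> carrier_vec n"
  shows "v \<bullet>c w = (\<Sum>i<n. v $ i * cnj (w $ i))"
  using assms by (auto simp: scalar_prod_def atLeast0LessThan)

lemma mat_adjoint_dims [simp]:
  "dim_row (mat_adjoint A) = dim_col A" "dim_col (mat_adjoint A) = dim_row A"
  by (simp_all add: mat_adjoint_def)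

lemma mat_adjoint_carrier:
  "A \<in> carrier_mat nr nc \<Longrightarrow> mat_adjoint A \<in> carrier_mat nc nr"
  by (auto simp: mat_adjoint_def)

lemma mat_adjoint_index:
  fixes A :: "complex mat"
  assumes "A \<in> carrier_mat nr nc" "i < nc" "j < nr"
  shows "mat_adjoint A $$ (i, j) = cnj (A $$ (j, i))"
  using assms by (auto simp: mat_adjoint_def mat_of_rows_index)

lemma mat_adjoint_adjoint:
  fixes A :: "complex mat"
  assumes A: "A \<in> carrier_mat nr nc"
  shows "mat_adjoint (mat_adjoint A) = A"
proof (rule eq_matI)
  fix i j assume "i < dim_row A" "j < dim_col A"
  then show "mat_adjoint (mat_adjoint A) $$ (i, j) = A $$ (i, j)"
    using A by (simp add: mat_adjoint_index[OF A] mat_adjoint_index[OF mat_adjoint_carrier[OF A]])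
qed (use A mat_adjoint_carrier[OF mat_adjoint_carrier[OF A]] in auto)

lemma mat_adjoint_mult:
  fixes A B :: "complex mat"
  assumes A: "A \<in> carrier_mat nr n" and B: "B \<in> carrier_mat n nc"
  shows "mat_adjoint (A * B) = mat_adjoint B * mat_adjoint A"
proof (rule eq_matI)
  have AB: "A * B \<in> carrier_mat nr nc" using A B by auto
  note A' = mat_adjoint_carrier[OF A] and B' = mat_adjoint_carrier[OF B]
  show "dim_row (mat_adjoint (A * B)) = dim_row (mat_adjoint B * mat_adjoint A)"
    "dim_col (mat_adjoint (A * B)) = dim_col (mat_adjoint B * mat_adjoint A)"
    using mat_adjoint_carrier[OF AB] A' B' by auto
  fix i j assume "i < dim_row (mat_adjoint B * mat_adjoint A)" "j < dim_col (mat_adjoint B * mat_adjoint A)"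
  then have i: "i < nc" and j: "j < nr" using A' B' by auto
  have "mat_adjoint (A * B) $$ (i, j) = cnj (row A j \<bullet> col B i)"
    using i j A B by (simp add: mat_adjoint_index[OF AB])
  also have "\<dots> = (\<Sum>k<n. cnj (A $$ (j, k)) * cnj (B $$ (k, i)))"
    using i j A B by (auto simp: scalar_prod_def atLeast0LessThan)
  also have "\<dots> = row (mat_adjoint B) i \<bullet> col (mat_adjoint A) j"
    using i j A B A' B'
    by (auto simp: scalar_prod_def atLeast0LessThan mat_adjoint_index[OF A]
        mat_adjoint_index[OF B] mult.commute intro!: sum.cong)
  finally show "mat_adjoint (A * B) $$ (i, j) = (mat_adjoint B * mat_adjoint A) $$ (i, j)"
    using i j A B by simp
qed

lemma cprod_adjoint:
  fixes A :: "complex mat"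
  assumes A: "A \<in> carrier_mat nr nc" and v: "v \<in> carrier_vec nc" and w: "w \<in> carrier_vec nr"
  shows "(A *\<^sub>v v) \<bullet>c w = v \<bullet>c (mat_adjoint A *\<^sub>v w)"
proof -
  note A' = mat_adjoint_carrier[OF A]
  have Av: "A *\<^sub>v v \<in> carrier_vec nr" and Aw: "mat_adjoint A *\<^sub>v w \<in> carrier_vec nc"
    using mult_mat_vec_carrier[OF A v] mult_mat_vec_carrier[OF A' w] by auto
  have "(A *\<^sub>v v) \<bullet>c w = (\<Sum>i<nr. \<Sum>j<nc. A $$ (i, j) * v $ j * cnj (w $ i))"
    unfolding cprod_sum[OF Av w]
    using A v by (simp add: scalar_prod_def atLeast0LessThan sum_distrib_right)
  also have "\<dots> = (\<Sum>j<nc. \<Sum>i<nr. A $$ (i, j) * v $ j * cnj (w $ i))"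
    by (rule sum.swap)
  also have "\<dots> = v \<bullet>c (mat_adjoint A *\<^sub>v w)"
    unfolding cprod_sum[OF v Aw]
    using A w by (simp add: scalar_prod_def atLeast0LessThan
        sum_distrib_left mat_adjoint_index[OF A] mult_ac)
  finally show ?thesis .
qed

lemma smult_mat_mult_vec:
  fixes A :: "'a :: comm_ring_1 mat"
  assumes "A \<in> carrier_mat nr nc" "v \<in> carrier_vec nc"
  shows "(a \<cdot>\<^sub>m A) *\<^sub>v v = a \<cdot>\<^sub>v (A *\<^sub>v v)"
proof (rule eq_vecI)
  fix i assume "i < dim_vec (a \<cdot>\<^sub>v (A *\<^sub>v v))"
  then have i: "i < dim_row A" by simp
  have "(a \<cdot>\<^sub>v row A i) \<bullet> v = a * (row A i \<bullet> v)"
    using assms i by (intro smult_scalar_prod_distrib[of _ nc]) auto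
  then show "((a \<cdot>\<^sub>m A) *\<^sub>v v) $ i = (a \<cdot>\<^sub>v (A *\<^sub>v v)) $ i" using i by simp
qed simp

lemma norm2_vec_sq: "(norm2_vec v)\<^sup>2 = (\<Sum>m<dim_vec v. (cmod (v $ m))\<^sup>2)"
  by (simp add: norm2_vec_def sum_nonneg)

lemma norm_inf_vec_le_iff:
  assumes "0 \<le> \<mu>"
  shows "norm_inf_vec v \<le> \<mu> \<longleftrightarrow> (\<forall>m<dim_vec v. cmod (v $ m) \<le> \<mu>)"
  using assms by (auto simp: norm_inf_vec_def)

section \<open>The pseudoinverse of a matrix of full row rank\<close>

text \<open>A maximal independent set of columns has \<open>N\<close> elements, the dimension of the whole space,
  so the columns already span it.\<close>

lemma full_row_rank_surj:
  fixes A :: "complex mat"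
  assumes A: "A \<in> carrier_mat N M" and rank: "vec_space.rank N A = N"
    and v: "v \<in> carrier_vec N"
  obtains x where "x \<in> carrier_vec M" "A *\<^sub>v x = v"
proof -
  interpret vec_space "TYPE(complex)" N .
  let ?S = "set (cols A)"
  have S: "?S \<subseteq> carrier_vec N" using A cols_dim by blast
  obtain B where B: "maximal B (\<lambda>T. T \<subseteq> ?S \<and> lin_indpt T)"
    using maximal_exists_superset[of ?S "\<lambda>T. T \<subseteq> ?S \<and> lin_indpt T" "{}"]
    by (auto simp: lin_dep_def)
  then have BS: "B \<subseteq> ?S" and ind: "lin_indpt B" by (auto simp: maximal_def)
  have card: "card B = N" using rank_card_indpt[OF A B] rank by simp
  have "basis B"
    using S BS ind card by (intro dim_li_is_basis) (auto simp: dim_is_n intro: finite_subset)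
  then have "carrier_vec N = span B" by (simp add: basis_def)
  also have "\<dots> \<subseteq> col_space A" unfolding col_space_def by (rule span_is_monotone[OF BS])
  finally show ?thesis using v A that by (auto simp: col_space_eq[OF A])
qed

text \<open>The projections $AX$ and $AY$ have the same range and are self-adjoint, so they agree;
  likewise $XA$ and $YA$. Then $X = XAX = YAX = YAY = Y$. Uniqueness is what allows
  \<open>pinv\<close> to be computed by exhibiting one solution of the Penrose equations.\<close>

lemma moore_penrose_unique:
  assumes X: "moore_penrose A X" and Y: "moore_penrose A Y"
  shows "X = Y"
proof -
  define m n where "m = dim_row A" and "n = dim_col A"
  have A: "A \<in> carrier_mat m n" by (simp add: m_def n_def)
  have Xc: "X \<in> carrier_mat n m" and Yc: "Y \<in> carrier_mat n m"
    using X Y by (auto simp: moore_penrose_def m_def n_def)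
  have X1: "A * X * A = A" and X2: "X * A * X = X"
    and X3: "mat_adjoint (A * X) = A * X" and X4: "mat_adjoint (X * A) = X * A"
    using X by (auto simp: moore_penrose_def)
  have Y1: "A * Y * A = A" and Y2: "Y * A * Y = Y"
    and Y3: "mat_adjoint (A * Y) = A * Y" and Y4: "mat_adjoint (Y * A) = Y * A"
    using Y by (auto simp: moore_penrose_def)
  have AX: "A * X \<in> carrier_mat m m" and AY: "A * Y \<in> carrier_mat m m"
    and XA: "X * A \<in> carrier_mat n n" and YA: "Y * A \<in> carrier_mat n n"
    using A Xc Yc by auto
  have "(A * Y) * (A * X) = A * X"
    using assoc_mult_mat[OF AY A Xc] Y1 by simp
  then have "A * X = mat_adjoint ((A * Y) * (A * X))" using X3 by simp
  also have "\<dots> = (A * X) * (A * Y)" by (simp add: mat_adjoint_mult[OF AY AX] X3 Y3)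
  also have "\<dots> = A * Y" using assoc_mult_mat[OF AX A Yc] X1 by simp
  finally have AXY: "A * X = A * Y" .
  have "(X * A) * (Y * A) = X * A"
    using assoc_mult_mat[OF Xc A YA] assoc_mult_mat[OF A Yc A] Y1 by simp
  then have "X * A = mat_adjoint ((X * A) * (Y * A))" using X4 by simp
  also have "\<dots> = (Y * A) * (X * A)" by (simp add: mat_adjoint_mult[OF XA YA] X4 Y4)
  also have "\<dots> = Y * A"
    using assoc_mult_mat[OF Yc A XA] assoc_mult_mat[OF A Xc A] X1 by simp
  finally have XAY: "X * A = Y * A" .
  have "X = Y * A * X" using X2 XAY by simp
  also have "\<dots> = Y * (A * Y)" using assoc_mult_mat[OF Yc A Xc] AXY by simp
  also have "\<dots> = Y" using assoc_mult_mat[OF Yc A Yc] Y2 by simp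
  finally show ?thesis .
qed

text \<open>If $AA^Hv=0$ then $\|A^Hv\|^2=0$, and writing $v=Ax$ by surjectivity gives
  $\|v\|^2 = \langle x, A^Hv\rangle = 0$.\<close>

lemma gram_matrix_inverse:
  fixes A :: "complex mat"
  assumes A: "A \<in> carrier_mat N M" and rank: "vec_space.rank N A = N"
  obtains B where "B \<in> carrier_mat N N" "A * mat_adjoint A * B = 1\<^sub>m N" "B * (A * mat_adjoint A) = 1\<^sub>m N"
proof -
  let ?G = "A * mat_adjoint A"
  note A' = mat_adjoint_carrier[OF A]
  have G: "?G \<in> carrier_mat N N" using A A' by simp
  have "v = 0\<^sub>v N" if v: "v \<in> carrier_vec N" and Gv: "?G *\<^sub>v v = 0\<^sub>v N" for v
  proof -
    let ?w = "mat_adjoint A *\<^sub>v v"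
    have w: "?w \<in> carrier_vec M" using A' v by simp
    have "?w \<bullet>c ?w = (A *\<^sub>v ?w) \<bullet>c v" by (rule cprod_adjoint[OF A w v, symmetric])
    also have "A *\<^sub>v ?w = 0\<^sub>v N" using Gv A A' v by simp
    finally have w0: "?w = 0\<^sub>v M" using w v by simp
    obtain x where x: "x \<in> carrier_vec M" "A *\<^sub>v x = v" by (rule full_row_rank_surj[OF A rank v])
    have "v \<bullet>c v = x \<bullet>c ?w" using cprod_adjoint[OF A x(1) v] x(2) by simp
    then show ?thesis using w0 x v by simp
  qed
  then have "det ?G \<noteq> 0" using det_0_iff_vec_prod_zero_field[OF G] by blast
  from det_non_zero_imp_unit[OF G this, of "()"] show ?thesis
    using that by (auto simp: Units_def ring_mat_def)
qed

text \<open>For full row rank the pseudoinverse is $A^H(AA^H)^{-1}$, a right inverse of $A$.\<close>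

lemma pinv_full_row_rank:
  fixes A :: "complex mat"
  assumes A: "A \<in> carrier_mat N M" and rank: "vec_space.rank N A = N"
  shows "pinv A \<in> carrier_mat M N" "A * pinv A = 1\<^sub>m N"
proof -
  let ?A' = "mat_adjoint A"
  let ?G = "A * ?A'"
  note A' = mat_adjoint_carrier[OF A]
  have G: "?G \<in> carrier_mat N N" using A A' by simp
  obtain B where B: "B \<in> carrier_mat N N" and GB: "?G * B = 1\<^sub>m N" and BG: "B * ?G = 1\<^sub>m N"
    by (rule gram_matrix_inverse[OF A rank])
  note B' = mat_adjoint_carrier[OF B]
  have one: "mat_adjoint (1\<^sub>m N) = (1\<^sub>m N :: complex mat)"
    using mat_adjoint_carrier[OF one_carrier_mat[of N]]
    by (intro eq_matI) (auto simp: mat_adjoint_index[OF one_carrier_mat])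
  have "mat_adjoint ?G = ?G" by (simp add: mat_adjoint_mult[OF A A'] mat_adjoint_adjoint[OF A])
  then have "mat_adjoint B * ?G = 1\<^sub>m N" using GB mat_adjoint_mult[OF G B] one by simp
  then have "mat_adjoint B * ?G * B = B" using B by simp
  then have Bh: "mat_adjoint B = B"
    using assoc_mult_mat[OF B' G B] GB right_mult_one_mat[OF B'] by metis
  let ?X = "?A' * B"
  have X: "?X \<in> carrier_mat M N" using A' B by simp
  have AX: "A * ?X = 1\<^sub>m N" using assoc_mult_mat[OF A A' B] GB by simp
  have "mat_adjoint (?X * A) = ?A' * mat_adjoint ?X" by (rule mat_adjoint_mult[OF X A])
  also have "\<dots> = ?A' * (B * A)"
    by (simp add: mat_adjoint_mult[OF A' B] mat_adjoint_adjoint[OF A] Bh)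
  also have "\<dots> = ?X * A" by (rule assoc_mult_mat[OF A' B A, symmetric])
  finally have XA: "mat_adjoint (?X * A) = ?X * A" .
  have "?X * A * ?X = ?X" using assoc_mult_mat[OF X A X] AX right_mult_one_mat[OF X] by simp
  with X AX XA one A have mp: "moore_penrose A ?X" by (simp add: moore_penrose_def)
  then have "pinv A = ?X"
    unfolding pinv_def by (rule the_equality) (rule moore_penrose_unique[OF _ mp])
  with X AX show "pinv A \<in> carrier_mat M N" "A * pinv A = 1\<^sub>m N" by simp_all
qed

section \<open>The null space constraint\<close>

lemma kernel_eq_range:
  assumes A: "A \<in> carrier_mat N M" and U: "orthonormal_kernel_basis A U"
  shows "mat_kernel A = {U *\<^sub>v c | c. c \<in> carrier_vec (dim_col U)}"
proof -
  interpret kernel N M A by unfold_locales (rule A)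
  have Uc: "U \<in> carrier_mat M (dim_col U)" and b: "basis (set (cols U))"
    using U A by (auto simp: orthonormal_kernel_basis_def)
  then have sub: "set (cols U) \<subseteq> mat_kernel A" and "mat_kernel A = span (set (cols U))"
    by (auto simp: Ker.basis_def)
  then have "mat_kernel A = NC.col_space U" using span_same[OF sub] by (simp add: NC.col_space_def)
  also have "\<dots> = {U *\<^sub>v c | c. c \<in> carrier_vec (dim_col U)}"
    using mult_mat_vec_carrier[OF Uc] carrier_matD(1)[OF Uc]
    unfolding NC.col_space_eq[OF Uc] by auto
  finally show ?thesis .
qed

text \<open>With $\xi=Uc$ one has $u^HD\xi = ((DU)^Hu)^H c$, and a vector orthogonal to every $c$
  is zero.\<close>

lemma adjoint_constraint_iff:
  fixes D :: "complex mat"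
  assumes A: "A \<in> carrier_mat N M" and U: "orthonormal_kernel_basis A U"
    and D: "D \<in> carrier_mat k M" and u: "u \<in> carrier_vec k"
  shows "mat_adjoint (D * U) *\<^sub>v u = 0\<^sub>v (dim_col U) \<longleftrightarrow> (\<forall>\<xi>\<in>mat_kernel A. (D *\<^sub>v \<xi>) \<bullet>c u = 0)"
proof -
  let ?w = "mat_adjoint (D * U) *\<^sub>v u"
  have Uc: "U \<in> carrier_mat M (dim_col U)" using U A by (auto simp: orthonormal_kernel_basis_def)
  have DU: "D * U \<in> carrier_mat k (dim_col U)" by (rule mult_carrier_mat[OF D Uc])
  have w: "?w \<in> carrier_vec (dim_col U)" by (rule mult_mat_vec_carrier[OF mat_adjoint_carrier[OF DU] u])
  have eq: "(D *\<^sub>v (U *\<^sub>v c)) \<bullet>c u = c \<bullet>c ?w" if c: "c \<in> carrier_vec (dim_col U)" for c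
    using cprod_adjoint[OF DU c u] assoc_mult_mat_vec[OF D Uc c] by simp
  have "(\<forall>c\<in>carrier_vec (dim_col U). c \<bullet>c ?w = 0) \<longleftrightarrow> ?w = 0\<^sub>v (dim_col U)"
    using w by (metis conjugate_square_eq_0_vec conjugate_zero_vec scalar_prod_right_zero)
  then show ?thesis unfolding kernel_eq_range[OF A U] using eq by auto
qed

section \<open>The Lagrangian\<close>

lemma complete_square:
  fixes y b p :: "complex vec"
  assumes y: "y \<in> carrier_vec n" and b: "b \<in> carrier_vec n" and p: "p \<in> carrier_vec n"
  shows "(norm2_vec (y - b))\<^sup>2 + 2 * Re (b \<bullet>c p) =
    Re (y \<bullet>c y) - (norm2_vec (y - p))\<^sup>2 + (norm2_vec (y - b - p))\<^sup>2"
proof -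
  have "(cmod (y $ i - b $ i))\<^sup>2 + 2 * Re (b $ i * cnj (p $ i)) =
      Re (y $ i * cnj (y $ i)) - (cmod (y $ i - p $ i))\<^sup>2 + (cmod (y $ i - b $ i - p $ i))\<^sup>2" for i
    unfolding cmod_power2 by (simp add: power2_eq_square algebra_simps)
  then have "(\<Sum>i<n. (cmod (y $ i - b $ i))\<^sup>2 + 2 * Re (b $ i * cnj (p $ i))) =
      (\<Sum>i<n. Re (y $ i * cnj (y $ i)) - (cmod (y $ i - p $ i))\<^sup>2 + (cmod (y $ i - b $ i - p $ i))\<^sup>2)"
    by (intro sum.cong refl)
  then show ?thesis
    unfolding cprod_sum[OF b p] cprod_sum[OF y y] norm2_vec_sq
    using y b p by (simp add: sum.distrib sum_subtractf sum_distrib_left Re_sum)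
qed

text \<open>The easy half of the duality between the $1$-norm and the maximum norm.\<close>

lemma Re_cprod_le:
  assumes z: "z \<in> carrier_vec n" and u: "u \<in> carrier_vec n" and le: "norm_inf_vec u \<le> \<mu>" and mu: "0 \<le> \<mu>"
  shows "Re (z \<bullet>c u) \<le> \<mu> * norm1_vec z"
proof -
  have "Re (z \<bullet>c u) = (\<Sum>i<n. Re (z $ i * cnj (u $ i)))" by (simp only: cprod_sum[OF z u] Re_sum)
  also have "\<dots> \<le> (\<Sum>i<n. \<mu> * cmod (z $ i))"
  proof (rule sum_mono)
    fix i assume i: "i \<in> {..<n}"
    then have "cmod (u $ i) \<le> \<mu>" using le mu u by (auto simp: norm_inf_vec_le_iff)
    then have "cmod (z $ i) * cmod (u $ i) \<le> cmod (z $ i) * \<mu>" by (rule mult_left_mono) simp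
    then show "Re (z $ i * cnj (u $ i)) \<le> \<mu> * cmod (z $ i)"
      using complex_Re_le_cmod[of "z $ i * cnj (u $ i)"]
      by (simp add: norm_mult mult.commute)
  qed
  also have "\<dots> = \<mu> * norm1_vec z" using z by (simp add: norm1_vec_def sum_distrib_left)
  finally show ?thesis .
qed

lemma lagrangian_split:
  assumes D: "D \<in> carrier_mat k M" and x: "x \<in> carrier_vec M" and z: "z \<in> carrier_vec k"
    and u: "u \<in> carrier_vec k"
  shows "lagrangian y A D \<mu> x z u =
    (norm2_vec (y - A *\<^sub>v x))\<^sup>2 + Re ((D *\<^sub>v x) \<bullet>c u) + (\<mu> * norm1_vec z - Re (z \<bullet>c u))"
proof -
  have "(D *\<^sub>v x - z) \<bullet>c u = (D *\<^sub>v x) \<bullet>c u - z \<bullet>c u"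
    by (rule minus_scalar_prod_distrib[OF mult_mat_vec_carrier[OF D x] z carrier_vec_conjugate[OF u]])
  then show ?thesis by (simp add: lagrangian_def)
qed

text \<open>A linear form vanishing on the null space of $A$ factors through $A$; the pseudoinverse gives
  the factor explicitly, as $x$ may be replaced by $A^+Ax$. The factor $2$ cancels the $\frac12$ in
  $\tilde D$ and is the one that completing the square asks for.\<close>

lemma cprod_D_tilde:
  assumes A: "A \<in> carrier_mat N M" and rank: "vec_space.rank N A = N"
    and D: "D \<in> carrier_mat k M" and u: "u \<in> carrier_vec k" and x: "x \<in> carrier_vec M"
    and orth: "\<forall>\<xi>\<in>mat_kernel A. (D *\<^sub>v \<xi>) \<bullet>c u = 0"
  shows "(D *\<^sub>v x) \<bullet>c u = 2 * ((A *\<^sub>v x) \<bullet>c (mat_adjoint (D_tilde A D) *\<^sub>v u))"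
proof -
  note P = pinv_full_row_rank[OF A rank]
  have DP: "D * pinv A \<in> carrier_mat k N" by (rule mult_carrier_mat[OF D P(1)])
  have Dt: "D_tilde A D \<in> carrier_mat k N" using DP by (simp add: D_tilde_def)
  have b: "A *\<^sub>v x \<in> carrier_vec N" by (rule mult_mat_vec_carrier[OF A x])
  let ?w = "pinv A *\<^sub>v (A *\<^sub>v x)"
  have w: "?w \<in> carrier_vec M" by (rule mult_mat_vec_carrier[OF P(1) b])
  have "A *\<^sub>v ?w = A *\<^sub>v x" using assoc_mult_mat_vec[OF A P(1) b] P(2) b by simp
  then have "A *\<^sub>v (x - ?w) = 0\<^sub>v N" using mult_minus_distrib_mat_vec[OF A x w] b by simp
  then have "x - ?w \<in> mat_kernel A" using x w by (intro mat_kernelI[OF A]) auto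
  then have "(D *\<^sub>v (x - ?w)) \<bullet>c u = 0" using orth by blast
  moreover have "(D *\<^sub>v (x - ?w)) \<bullet>c u = (D *\<^sub>v x) \<bullet>c u - (D *\<^sub>v ?w) \<bullet>c u"
    using mult_minus_distrib_mat_vec[OF D x w]
      minus_scalar_prod_distrib[OF mult_mat_vec_carrier[OF D x] mult_mat_vec_carrier[OF D w]
        carrier_vec_conjugate[OF u]]
    by simp
  moreover have "D *\<^sub>v ?w = 2 \<cdot>\<^sub>v (D_tilde A D *\<^sub>v (A *\<^sub>v x))"
  proof -
    have "D_tilde A D *\<^sub>v (A *\<^sub>v x) = (1 / 2) \<cdot>\<^sub>v (D *\<^sub>v ?w)"
      unfolding D_tilde_def assoc_mult_mat_vec[OF D P(1) b, symmetric]
      by (rule smult_mat_mult_vec[OF DP b])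
    then show ?thesis by (simp add: smult_smult_assoc)
  qed
  moreover have "(2 \<cdot>\<^sub>v (D_tilde A D *\<^sub>v (A *\<^sub>v x))) \<bullet>c u = 2 * ((D_tilde A D *\<^sub>v (A *\<^sub>v x)) \<bullet>c u)"
    using mult_mat_vec_carrier[OF Dt b] u by simp
  ultimately show ?thesis using cprod_adjoint[OF Dt b u] by simp
qed

section \<open>The dual function\<close>

lemma INF_eq_minus_infinity_of_ray:
  fixes f :: "'a \<Rightarrow> real"
  assumes b: "0 < b" and ray: "\<And>t. 0 \<le> t \<Longrightarrow> \<exists>p\<in>S. f p \<le> a - t * b"
  shows "(INF p\<in>S. ereal (f p)) = - \<infinity>"
proof (rule ereal_bot)
  fix r
  \<comment> \<open>The value \<open>(a - r) / b\<close> may be negative, and then the start of the ray is already low enough.\<close>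
  obtain p where p: "p \<in> S" "f p \<le> a - max 0 ((a - r) / b) * b"
    using ray[of "max 0 ((a - r) / b)"] by auto
  have "a - r = (a - r) / b * b" using b by simp
  also have "\<dots> \<le> max 0 ((a - r) / b) * b" using b by (intro mult_right_mono) auto
  finally show "(INF p\<in>S. ereal (f p)) \<le> ereal r"
    using p by (intro INF_lower2[OF p(1)]) simp
qed

lemma dual_function_fst_snd:
  assumes "D \<in> carrier_mat k M"
  shows "dual_function y A D \<mu> u =
    (INF p \<in> carrier_vec M \<times> carrier_vec k. ereal (lagrangian y A D \<mu> (fst p) (snd p) u))"
  using assms by (simp add: dual_function_def case_prod_beta)

lemma dual_function_feasible:
  assumes y: "y \<in> carrier_vec N" and mu: "0 \<le> \<mu>"
    and A: "A \<in> carrier_mat N M" and rank: "vec_space.rank N A = N"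
    and D: "D \<in> carrier_mat k M" and u: "u \<in> carrier_vec k"
    and le: "norm_inf_vec u \<le> \<mu>" and orth: "\<forall>\<xi>\<in>mat_kernel A. (D *\<^sub>v \<xi>) \<bullet>c u = 0"
  shows "dual_function y A D \<mu> u = ereal (dual_objective y A D u)"
proof -
  note P = pinv_full_row_rank[OF A rank]
  define p where "p = mat_adjoint (D_tilde A D) *\<^sub>v u"
  have "D_tilde A D \<in> carrier_mat k N"
    using mult_carrier_mat[OF D P(1)] by (simp add: D_tilde_def)
  then have p: "p \<in> carrier_vec N"
    unfolding p_def using u by (intro mult_mat_vec_carrier[OF mat_adjoint_carrier])
  have val: "dual_objective y A D u = Re (y \<bullet>c y) - (norm2_vec (y - p))\<^sup>2"
    using P(2) y by (simp add: dual_objective_def y_tilde_def p_def)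
  have L: "lagrangian y A D \<mu> x z u = dual_objective y A D u
      + (norm2_vec (y - A *\<^sub>v x - p))\<^sup>2 + (\<mu> * norm1_vec z - Re (z \<bullet>c u))"
    if x: "x \<in> carrier_vec M" and z: "z \<in> carrier_vec k" for x z
    using complete_square[OF y mult_mat_vec_carrier[OF A x] p]
      cprod_D_tilde[OF A rank D u x orth] val
    by (simp add: lagrangian_split[OF D x z u] p_def)
  \<comment> \<open>The minimizer: \<open>A\<close> maps it to \<open>y - p\<close>, where the completed square vanishes.\<close>
  let ?x = "pinv A *\<^sub>v (y - p)"
  have yp: "y - p \<in> carrier_vec N" using y p by simp
  have x: "?x \<in> carrier_vec M" by (rule mult_mat_vec_carrier[OF P(1) yp])
  have "A *\<^sub>v ?x = y - p" using assoc_mult_mat_vec[OF A P(1) yp] P(2) yp by simp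
  moreover have "y - (y - p) - p = 0\<^sub>v N" using y p by auto
  ultimately have att: "lagrangian y A D \<mu> ?x (0\<^sub>v k) u = dual_objective y A D u"
    using u by (simp add: L[OF x] norm2_vec_def norm1_vec_def)
  show ?thesis unfolding dual_function_fst_snd[OF D]
  proof (rule antisym)
    show "(INF p \<in> carrier_vec M \<times> carrier_vec k. ereal (lagrangian y A D \<mu> (fst p) (snd p) u))
        \<le> ereal (dual_objective y A D u)"
      using x att by (intro INF_lower2[of "(?x, 0\<^sub>v k)"]) auto
    show "ereal (dual_objective y A D u)
        \<le> (INF p \<in> carrier_vec M \<times> carrier_vec k. ereal (lagrangian y A D \<mu> (fst p) (snd p) u))"
      using Re_cprod_le[OF _ u le mu] by (intro INF_greatest) (auto simp: L)
  qed
qed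

lemma dual_function_norm_inf_gt:
  assumes mu: "0 \<le> \<mu>" and A: "A \<in> carrier_mat N M" and D: "D \<in> carrier_mat k M"
    and u: "u \<in> carrier_vec k" and gt: "\<not> norm_inf_vec u \<le> \<mu>"
  shows "dual_function y A D \<mu> u = - \<infinity>"
proof -
  obtain m where m: "m < k" and um: "\<mu> < cmod (u $ m)"
    using gt mu u by (auto simp: norm_inf_vec_le_iff not_le)
  let ?c = "cmod (u $ m)"
  show ?thesis unfolding dual_function_fst_snd[OF D]
  proof (rule INF_eq_minus_infinity_of_ray)
    show "0 < ?c * (?c - \<mu>)" using um mu by (intro mult_pos_pos) auto
    fix t :: real assume t: "0 \<le> t"
    \<comment> \<open>Moving \<open>z $ m\<close> in the direction of \<open>u $ m\<close> makes the pairing real and as large as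
      its modulus allows.\<close>
    define z where "z = vec k (\<lambda>i. if i = m then complex_of_real t * u $ m else 0)"
    have z: "z \<in> carrier_vec k" by (simp add: z_def)
    have "norm1_vec z = (\<Sum>i<k. if i = m then t * ?c else 0)"
      unfolding norm1_vec_def by (rule sum.cong) (use t in \<open>auto simp: z_def norm_mult\<close>)
    then have n: "norm1_vec z = t * ?c" using m by simp
    have "z \<bullet>c u = (\<Sum>i<k. if i = m then complex_of_real t * u $ m * cnj (u $ m) else 0)"
      unfolding cprod_sum[OF z u] by (rule sum.cong) (auto simp: z_def)
    also have "\<dots> = complex_of_real t * (u $ m * cnj (u $ m))" using m by simp
    also have "u $ m * cnj (u $ m) = complex_of_real (?c\<^sup>2)" by (rule complex_norm_square[symmetric])
    finally have r: "Re (z \<bullet>c u) = t * ?c\<^sup>2" by simp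
    have "D *\<^sub>v 0\<^sub>v M = 0\<^sub>v k" using D by auto
    then have "lagrangian y A D \<mu> (0\<^sub>v M) z u
        = (norm2_vec (y - A *\<^sub>v 0\<^sub>v M))\<^sup>2 - t * (?c * (?c - \<mu>))"
      using u lagrangian_split[OF D zero_carrier_vec z u, of y A \<mu>]
      by (simp add: n r power2_eq_square algebra_simps)
    then show "\<exists>p\<in>carrier_vec M \<times> carrier_vec k. lagrangian y A D \<mu> (fst p) (snd p) u
        \<le> (norm2_vec (y - A *\<^sub>v 0\<^sub>v M))\<^sup>2 - t * (?c * (?c - \<mu>))"
      using z by (intro bexI[of _ "(0\<^sub>v M, z)"]) auto
  qed
qed

lemma dual_function_not_orthogonal:
  assumes A: "A \<in> carrier_mat N M" and D: "D \<in> carrier_mat k M"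
    and u: "u \<in> carrier_vec k" and \<xi>: "\<xi> \<in> mat_kernel A" and ne: "(D *\<^sub>v \<xi>) \<bullet>c u \<noteq> 0"
  shows "dual_function y A D \<mu> u = - \<infinity>"
proof -
  let ?c = "(D *\<^sub>v \<xi>) \<bullet>c u"
  note \<xi>M = mat_kernelD[OF A \<xi>]
  show ?thesis unfolding dual_function_fst_snd[OF D]
  proof (rule INF_eq_minus_infinity_of_ray)
    show "0 < (cmod ?c)\<^sup>2" using ne by simp
    fix t :: real assume "0 \<le> t"
    \<comment> \<open>The conjugate turns the value of the linear form into a negative real.\<close>
    define s where "s = - complex_of_real t * cnj ?c"
    have x: "s \<cdot>\<^sub>v \<xi> \<in> carrier_vec M" using \<xi>M by simp
    have Ax: "A *\<^sub>v (s \<cdot>\<^sub>v \<xi>) = 0\<^sub>v N" using mat_kernelD(2)[OF A mat_kernel_smult[OF A \<xi>]] .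
    have "(D *\<^sub>v (s \<cdot>\<^sub>v \<xi>)) \<bullet>c u = s * ?c"
      using mult_mat_vec[OF D \<xi>M(1)] mult_mat_vec_carrier[OF D \<xi>M(1)] u by simp
    also have "\<dots> = - complex_of_real t * (?c * cnj ?c)" by (simp add: s_def)
    also have "?c * cnj ?c = complex_of_real ((cmod ?c)\<^sup>2)" by (rule complex_norm_square[symmetric])
    finally have r: "Re ((D *\<^sub>v (s \<cdot>\<^sub>v \<xi>)) \<bullet>c u) = - (t * (cmod ?c)\<^sup>2)" by simp
    have "lagrangian y A D \<mu> (s \<cdot>\<^sub>v \<xi>) (0\<^sub>v k) u = (norm2_vec (y - 0\<^sub>v N))\<^sup>2 - t * (cmod ?c)\<^sup>2"
      using u lagrangian_split[OF D x zero_carrier_vec u, of y A \<mu>]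
      by (simp add: Ax r norm1_vec_def)
    then show "\<exists>p\<in>carrier_vec M \<times> carrier_vec k. lagrangian y A D \<mu> (fst p) (snd p) u
        \<le> (norm2_vec (y - 0\<^sub>v N))\<^sup>2 - t * (cmod ?c)\<^sup>2"
      using x by (intro bexI[of _ "(s \<cdot>\<^sub>v \<xi>, 0\<^sub>v k)"]) auto
  qed
qed

lemma dual_function_eq:
  assumes y: "y \<in> carrier_vec N" and mu: "0 \<le> \<mu>"
    and A: "A \<in> carrier_mat N M" and rank: "vec_space.rank N A = N"
    and D: "D \<in> carrier_mat k M" and U: "orthonormal_kernel_basis A U" and u: "u \<in> carrier_vec k"
  shows "dual_function y A D \<mu> u =
    (if u \<in> dual_feasible D U \<mu> then ereal (dual_objective y A D u) else - \<infinity>)"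
proof -
  have "u \<in> dual_feasible D U \<mu> \<longleftrightarrow>
      norm_inf_vec u \<le> \<mu> \<and> (\<forall>\<xi>\<in>mat_kernel A. (D *\<^sub>v \<xi>) \<bullet>c u = 0)"
    using u D by (auto simp: dual_feasible_def adjoint_constraint_iff[OF A U D u])
  then show ?thesis
    using dual_function_feasible[OF y mu A rank D u] dual_function_norm_inf_gt[OF mu A D u]
      dual_function_not_orthogonal[OF A D u]
    by auto
qed

section \<open>Equivalence of the optimization problems\<close>

lemma split_feasible_image:
  assumes "D \<in> carrier_mat k M"
  shows "split_feasible D = (\<lambda>x. (x, D *\<^sub>v x)) ` carrier_vec M"
  using assms mult_mat_vec_carrier[OF assms] by (auto simp: split_feasible_def)

text \<open>Nonemptiness of \<open>F\<close> is essential: otherwise \<open>f\<close> is constantly \<open>-\<infinity>\<close> on \<open>S\<close> and every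
  point of \<open>S\<close> is a maximizer.\<close>

lemma is_arg_max_extend_minus_infinity:
  fixes g :: "'a \<Rightarrow> real"
  assumes f: "\<And>u. u \<in> S \<Longrightarrow> f u = (if u \<in> F then ereal (g u) else - \<infinity>)"
    and F: "F \<subseteq> S" "F \<noteq> {}"
  shows "is_arg_max f (\<lambda>u. u \<in> S) u \<longleftrightarrow> is_arg_max g (\<lambda>u. u \<in> F) u"
proof -
  obtain v where "v \<in> F" using F by blast
  then show ?thesis using F f by (auto simp: is_arg_max_def split: if_splits)
qed

lemma SUP_extend_minus_infinity:
  fixes g :: "'a \<Rightarrow> real"
  assumes f: "\<And>u. u \<in> S \<Longrightarrow> f u = (if u \<in> F then ereal (g u) else - \<infinity>)"
    and F: "F \<subseteq> S"
  shows "(SUP u\<in>S. f u) = (SUP u\<in>F. ereal (g u))"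
proof (rule antisym)
  show "(SUP u\<in>S. f u) \<le> (SUP u\<in>F. ereal (g u))"
    by (rule SUP_least) (auto simp: f intro: SUP_upper)
  show "(SUP u\<in>F. ereal (g u)) \<le> (SUP u\<in>S. f u)"
    using F by (intro SUP_mono) (auto simp: f subset_iff intro!: bexI)
qed

theorem mainTheorem1:
  fixes N M :: nat
    and y :: "complex vec"
    and \<mu> :: real
    and A D U :: "complex mat"
  assumes y: "y \<in> carrier_vec N"
    and mu: "\<mu> > 0"
    and A: "A \<in> carrier_mat N M"
    and full_row_rank: "vec_space.rank N A = N"
    and D: "D \<in> carrier_mat M M"
    and U: "orthonormal_kernel_basis A U"
  shows
    "(\<forall>x z. is_arg_min (\<lambda>(x, z). split_objective y A \<mu> x z) (\<lambda>p. p \<in> split_feasible D) (x, z) \<longleftrightarrow>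
         is_arg_min (lasso_objective y A D \<mu>) (\<lambda>x. x \<in> carrier_vec M) x \<and> z = D *\<^sub>v x)
     \<and> (INF (x, z) \<in> split_feasible D. ereal (split_objective y A \<mu> x z)) =
       (INF x \<in> carrier_vec M. ereal (lasso_objective y A D \<mu> x))
     \<and> (\<forall>u \<in> carrier_vec M.
         dual_function y A D \<mu> u =
           (if norm_inf_vec u \<le> \<mu> \<and> mat_adjoint (D * U) *\<^sub>v u = 0\<^sub>v (dim_col U)
            then ereal (Re (y \<bullet>c y)
                   - (norm2_vec (y_tilde A y - mat_adjoint (D_tilde A D) *\<^sub>v u))\<^sup>2)
            else -\<infinity>))
     \<and> (\<forall>u. is_arg_max (dual_function y A D \<mu>) (\<lambda>u. u \<in> carrier_vec M) u \<longleftrightarrow>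
         is_arg_max (dual_objective y A D) (\<lambda>u. u \<in> dual_feasible D U \<mu>) u)
     \<and> (SUP u \<in> carrier_vec M. dual_function y A D \<mu> u) =
       (SUP u \<in> dual_feasible D U \<mu>. ereal (dual_objective y A D u))"
proof (intro conjI)
  note dual = dual_function_eq[OF y less_imp_le[OF mu] A full_row_rank D U]
  have obj: "split_objective y A \<mu> x (D *\<^sub>v x) = lasso_objective y A D \<mu> x" for x
    by (simp add: split_objective_def lasso_objective_def)
  have sub: "dual_feasible D U \<mu> \<subseteq> carrier_vec M" using D by (auto simp: dual_feasible_def)
  have zero: "0\<^sub>v M \<in> carrier_vec M" "norm_inf_vec (0\<^sub>v M) \<le> \<mu>"
    using mu by (auto simp: norm_inf_vec_le_iff)
  have "mat_adjoint (D * U) *\<^sub>v 0\<^sub>v M = 0\<^sub>v (dim_col U)" 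
    unfolding adjoint_constraint_iff[OF A U D zero_carrier_vec]
    using scalar_prod_right_zero[OF mult_mat_vec_carrier[OF D]] mat_kernelD(1)[OF A] by simp
  then have ne: "dual_feasible D U \<mu> \<noteq> {}" using D zero by (auto simp: dual_feasible_def)
  show "\<forall>x z. is_arg_min (\<lambda>(x, z). split_objective y A \<mu> x z) (\<lambda>p. p \<in> split_feasible D) (x, z) \<longleftrightarrow>
      is_arg_min (lasso_objective y A D \<mu>) (\<lambda>x. x \<in> carrier_vec M) x \<and> z = D *\<^sub>v x"
    by (auto simp: is_arg_min_def split_feasible_image[OF D] obj)
  show "(INF (x, z) \<in> split_feasible D. ereal (split_objective y A \<mu> x z)) =
      (INF x \<in> carrier_vec M. ereal (lasso_objective y A D \<mu> x))"
    by (simp add: split_feasible_image[OF D] image_image obj)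
  show "\<forall>u \<in> carrier_vec M. dual_function y A D \<mu> u =
      (if norm_inf_vec u \<le> \<mu> \<and> mat_adjoint (D * U) *\<^sub>v u = 0\<^sub>v (dim_col U)
       then ereal (Re (y \<bullet>c y) - (norm2_vec (y_tilde A y - mat_adjoint (D_tilde A D) *\<^sub>v u))\<^sup>2)
       else -\<infinity>)"
    using D by (auto simp: dual dual_feasible_def dual_objective_def)
  show "\<forall>u. is_arg_max (dual_function y A D \<mu>) (\<lambda>u. u \<in> carrier_vec M) u \<longleftrightarrow>
      is_arg_max (dual_objective y A D) (\<lambda>u. u \<in> dual_feasible D U \<mu>) u"
    using is_arg_max_extend_minus_infinity[OF dual sub ne] by blast
  show "(SUP u \<in> carrier_vec M. dual_function y A D \<mu> u) =
      (SUP u \<in> dual_feasible D U \<mu>. ereal (dual_objective y A D u))"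
    by (rule SUP_extend_minus_infinity[OF dual sub])
qed

end
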